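(* Let $\mathcal{P}=\langle P^\iota\rangle_{\iota\in I}$ be a concurrent program, $F$ a set of local states of $\mathcal{P}$, and fix a type of objective (reachability or safety). Let $\mathcal{G}=\mathcal{G}(\mathcal{P})$ be the TSO game with the winning condition of that type induced by $F$, and for each $\iota\in I$ let $\mathcal{G}^\iota=\mathcal{G}(\langle P^\iota\rangle)$ be the TSO game of the single-process program $\langle P^\iota\rangle$ with the winning condition of the same type induced by $F\cap Q^\iota$. Let $c_0$ be a TSO configuration of $\mathcal{P}$ in which all buffers are empty and no process is in a state of $F$. Then the process player wins $\mathcal{G}$ from $(c_0)_A$ if and only if there exists $\iota\in I$ such that the process player wins $\mathcal{G}^\iota$ from $\langle s(c_0)(\iota),b(c_0)(\iota),m(c_0)\rangle_A$.
   Context: Let $V$ be a finite data domain and $X$ a finite set of shared variables over $V$. Instructions are $\mathrm{rd}(x,d)$, $\mathrm{wr}(x,d)$ ($x\in X,d\in V$), $\mathrm{skip}$ and $\mathrm{mf}$ (memory fence). A process is a finite labelled transition system $P=\langle Q,\mathrm{Instrs},\delta\rangle$. A concurrent program is a tuple $\mathcal{P}=\langle P^\iota\rangle_{\iota\in I}$, $I$ finite, $P^\iota=\langle Q^\iota,\mathrm{Instrs},\delta^\iota\rangle$. A TSO configuration is $c=\langle s,b,m\rangle$ with $s(\iota)\in Q^\iota$, $b:I\to (X\times V)^*$ (FIFO buffers; new messages added on the left, oldest on the right), $m:X\to V$. TSO transitions: (read-own-write) if $s(\iota)\xrightarrow{\mathrm{rd}(x,d)} q'$ and the most recent message on $x$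 in $b(\iota)$ is $\langle x,d\rangle$, move $s(\iota)$ to $q'$; (read-from-memory) if $s(\iota)\xrightarrow{\mathrm{rd}(x,d)}q'$, $b(\iota)$ has no message on $x$, and $m(x)=d$, move to $q'$; (write) if $s(\iota)\xrightarrow{\mathrm{wr}(x,d)}q'$, move to $q'$ and set $b(\iota):=\langle x,d\rangle\cdot b(\iota)$; (skip) move along a $\mathrm{skip}$ edge; (memory fence) if $s(\iota)\xrightarrow{\mathrm{mf}}q'$ and $b(\iota)=\varepsilon$, move to $q'$; (update) if $b(\iota)=w\cdot\langle x,d\rangle$, set $b(\iota):=w$, $m(x):=d$. $c\xrightarrow{\mathrm{up}^*}c'$ means zero or more updates. A game $\langle C,C_A,C_B,\to\rangle$: a play is an infinite sequence of moves or a finite one ending in a configuration with no successors. A winning condition is a set of infinite plays; player A wins a play if it is infinite and in the winning condition or finite ending in $C_B$; otherwise B wins. A configuration is winning for a player if she has a strategy winning against all opponent strategies. The TSO game $\mathcal{G}(\mathcal{P})$ has $C_A$, $C_B$ copies of all TSO configurations; the process player (A) moves $c_A\to c'_B$ for every instruction transition $c\to c'$ of any process; the update player (B) moves $c_B\to c'_A$ for every $c'$ with $c\xrightarrow{\mathrm{up}^*}c'$. For a set $F$ of local states, $C_F$ is the set of game configurations in which some process is in a state of $F$; the reachability condition is the set of plays visiting $C_F$, the safety condition the set of plays never visiting $C_F$. In reachability games it is assumed that no process can deadlock from a target state. *)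

theory Defs
  imports Main
begin

section \<open>Two-player games\<close>

record 'c game =
  confsA :: "'c set"
  confsB :: "'c set"
  moves :: "('c \<times> 'c) set"

datatype 'c play = FinPlay "'c list" | InfPlay "nat \<Rightarrow> 'c"

fun first_conf :: "'c play \<Rightarrow> 'c" where
  "first_conf (FinPlay h) = hd h"
| "first_conf (InfPlay r) = r 0"

fun is_play :: "'c game \<Rightarrow> 'c play \<Rightarrow> bool" where
  "is_play G (FinPlay h) \<longleftrightarrow>
     h \<noteq> [] \<and> set h \<subseteq> confsA G \<union> confsB G \<and>
     (\<forall>n. Suc n < length h \<longrightarrow> (h ! n, h ! Suc n) \<in> moves G) \<and>
     (\<nexists>c. (last h, c) \<in> moves G)"
| "is_play G (InfPlay r) \<longleftrightarrow>
     range r \<subseteq> confsA G \<union> confsB G \<and> (\<forall>n. (r n, r (Suc n)) \<in> moves G)"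

definition infinite_plays :: "'c game \<Rightarrow> (nat \<Rightarrow> 'c) set" where
  "infinite_plays G = {r. is_play G (InfPlay r)}"

fun won_by_A :: "'c game \<Rightarrow> (nat \<Rightarrow> 'c) set \<Rightarrow> 'c play \<Rightarrow> bool" where
  "won_by_A G W (FinPlay h) \<longleftrightarrow> last h \<in> confsB G"
| "won_by_A G W (InfPlay r) \<longleftrightarrow> r \<in> W"

text \<open>
  A strategy maps the nonempty history of the play, current configuration last, to the next
  configuration. It has to prescribe a legal move whenever the current configuration belongs
  to its owner (whose configurations form the set \<open>X\<close>) and has a successor.
\<close>

definition strategy :: "'c game \<Rightarrow> 'c set \<Rightarrow> ('c list \<Rightarrow> 'c) \<Rightarrow> bool" where
  "strategy G X \<sigma> \<longleftrightarrow>
     (\<forall>h c. c \<in> X \<and> (\<exists>c'. (c, c') \<in> moves G) \<longrightarrow> (c, \<sigma> (h @ [c])) \<in> moves G)"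

fun consistent :: "'c set \<Rightarrow> ('c list \<Rightarrow> 'c) \<Rightarrow> 'c play \<Rightarrow> bool" where
  "consistent X \<sigma> (FinPlay h) \<longleftrightarrow>
     (\<forall>n. Suc n < length h \<and> h ! n \<in> X \<longrightarrow> h ! Suc n = \<sigma> (take (Suc n) h))"
| "consistent X \<sigma> (InfPlay r) \<longleftrightarrow>
     (\<forall>n. r n \<in> X \<longrightarrow> r (Suc n) = \<sigma> (map r [0..<Suc n]))"

text \<open>
  If every configuration belongs to exactly one player, a strategy for each player and an
  initial configuration determine exactly one play \<open>\<rho>\<close> below.
\<close>

definition A_wins :: "'c game \<Rightarrow> (nat \<Rightarrow> 'c) set \<Rightarrow> 'c \<Rightarrow> bool" where
  "A_wins G W c \<longleftrightarrow>
     (\<exists>\<sigma>. strategy G (confsA G) \<sigma> \<and>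
       (\<forall>\<tau>. strategy G (confsB G) \<tau> \<longrightarrow>
         (\<forall>\<rho>. is_play G \<rho> \<and> first_conf \<rho> = c \<and>
              consistent (confsA G) \<sigma> \<rho> \<and> consistent (confsB G) \<tau> \<rho> \<longrightarrow>
              won_by_A G W \<rho>)))"


section \<open>Concurrent programs under TSO\<close>

datatype ('x, 'v) instr = Rd 'x 'v | Wr 'x 'v | Skip | Mf

record ('q, 'x, 'v) process =
  states :: "'q set"
  edges :: "('q \<times> ('x, 'v) instr \<times> 'q) set"

definition is_process :: "('q, 'x, 'v) process \<Rightarrow> bool" where
  "is_process p \<longleftrightarrow> finite (states p) \<and> edges p \<subseteq> states p \<times> UNIV \<times> states p"

text \<open>The index set of a program is the whole type \<open>'i\<close>.\<close>

type_synonym ('i, 'q, 'x, 'v) program = "'i \<Rightarrow> ('q, 'x, 'v) process"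

definition single :: "('q, 'x, 'v) process \<Rightarrow> (unit, 'q, 'x, 'v) program" where
  "single p = (\<lambda>_. p)"

record ('i, 'q, 'x, 'v) conf =
  loc :: "'i \<Rightarrow> 'q"
  buf :: "'i \<Rightarrow> ('x \<times> 'v) list"
  mem :: "'x \<Rightarrow> 'v"

definition confs :: "('i, 'q, 'x, 'v) program \<Rightarrow> ('i, 'q, 'x, 'v) conf set" where
  "confs P = {c. \<forall>i. loc c i \<in> states (P i)}"

definition proj :: "'i \<Rightarrow> ('i, 'q, 'x, 'v) conf \<Rightarrow> (unit, 'q, 'x, 'v) conf" where
  "proj i c = \<lparr>loc = \<lambda>_. loc c i, buf = \<lambda>_. buf c i, mem = mem c\<rparr>"

text \<open>
  The head of a buffer is its newest message. Reading a buffer as an association list,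
  \<^const>\<open>map_of\<close> therefore returns the value of the most recent message on a variable, and
  \<^const>\<open>None\<close> if there is no message on it.
\<close>

inductive instr_step ::
  "('i, 'q, 'x, 'v) program \<Rightarrow> ('i, 'q, 'x, 'v) conf \<Rightarrow> ('i, 'q, 'x, 'v) conf \<Rightarrow> bool"
  for P :: "('i, 'q, 'x, 'v) program"
where
  read_own_write:
    "(loc c i, Rd x d, q) \<in> edges (P i) \<Longrightarrow> map_of (buf c i) x = Some d \<Longrightarrow>
     instr_step P c (c\<lparr>loc := (loc c)(i := q)\<rparr>)"
| read_from_memory:
    "(loc c i, Rd x d, q) \<in> edges (P i) \<Longrightarrow> map_of (buf c i) x = None \<Longrightarrow> mem c x = d \<Longrightarrow>
     instr_step P c (c\<lparr>loc := (loc c)(i := q)\<rparr>)"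
| write_to_buffer:
    "(loc c i, Wr x d, q) \<in> edges (P i) \<Longrightarrow>
     instr_step P c (c\<lparr>loc := (loc c)(i := q), buf := (buf c)(i := (x, d) # buf c i)\<rparr>)"
| skip_instr:
    "(loc c i, Skip, q) \<in> edges (P i) \<Longrightarrow>
     instr_step P c (c\<lparr>loc := (loc c)(i := q)\<rparr>)"
| memory_fence:
    "(loc c i, Mf, q) \<in> edges (P i) \<Longrightarrow> buf c i = [] \<Longrightarrow>
     instr_step P c (c\<lparr>loc := (loc c)(i := q)\<rparr>)"

inductive update_step :: "('i, 'q, 'x, 'v) conf \<Rightarrow> ('i, 'q, 'x, 'v) conf \<Rightarrow> bool" where
  update:
    "buf c i = w @ [(x, d)] \<Longrightarrow>
     update_step c (c\<lparr>buf := (buf c)(i := w), mem := (mem c)(x := d)\<rparr>)"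


section \<open>TSO games\<close>

datatype 'c game_conf = ConfA (conf_of: 'c) | ConfB (conf_of: 'c)

definition tso_game ::
  "('i, 'q, 'x, 'v) program \<Rightarrow> ('i, 'q, 'x, 'v) conf game_conf game" where
  "tso_game P =
     \<lparr>confsA = ConfA ` confs P,
      confsB = ConfB ` confs P,
      moves = {(ConfA c, ConfB c') | c c'. c \<in> confs P \<and> instr_step P c c'} \<union>
              {(ConfB c, ConfA c') | c c'. c \<in> confs P \<and> update_step\<^sup>*\<^sup>* c c'}\<rparr>"

definition target_confs ::
  "('i, 'q, 'x, 'v) program \<Rightarrow> 'q set \<Rightarrow> ('i, 'q, 'x, 'v) conf game_conf set" where
  "target_confs P F = {g. conf_of g \<in> confs P \<and> (\<exists>i. loc (conf_of g) i \<in> F)}"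

datatype objective = Reachability | Safety

fun winning_condition ::
  "objective \<Rightarrow> ('i, 'q, 'x, 'v) program \<Rightarrow> 'q set \<Rightarrow>
   (nat \<Rightarrow> ('i, 'q, 'x, 'v) conf game_conf) set" where
  "winning_condition Reachability P F =
     {r \<in> infinite_plays (tso_game P). \<exists>n. r n \<in> target_confs P F}"
| "winning_condition Safety P F =
     {r \<in> infinite_plays (tso_game P). \<forall>n. r n \<notin> target_confs P F}"

text \<open>
  From a state of \<open>F\<close>, whatever the buffer and memory contents, the process cannot be driven
  into a deadlock: with the process \<open>p\<close> alone, the process player can make the play infinite.
  An enabled instruction in each state of \<open>F\<close> would not be enough, since the process could
  get stuck later, and then the finite play is lost although it has visited \<open>F\<close>.
\<close>

definition no_deadlock_from :: "('q, 'x, 'v) process \<Rightarrow> 'q set \<Rightarrow> bool" where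
  "no_deadlock_from p F \<longleftrightarrow>
     (\<forall>c \<in> confs (single p). loc c () \<in> F \<longrightarrow>
        A_wins (tso_game (single p)) (infinite_plays (tso_game (single p))) (ConfA c))"

end

theory Submission
  imports Defs
begin

text \<open>
  Delaying an update never helps the process player: a process reads its own buffer on top of
  the memory, so updates of its own messages do not change what it reads, whereas a non-empty
  buffer blocks fences. The update player may therefore never update. Then the memory is
  constant and the processes run independently, each on its own buffer. An infinite play
  avoiding \<open>F\<close> contains an infinite run of some process, and a play visiting \<open>F\<close> contains a finite
  run of some process into \<open>F\<close>, which extends to an infinite one as there are no deadlocks.
  Conversely, an infinite run of one process can be followed against arbitrary updates.
\<close>

section \<open>Reading through a buffer, and steps of a single process\<close>

text \<open>What a process with buffer \<open>b\<close> reads over memory \<open>m\<close>. It is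
  also the memory left after flushing all of \<open>b\<close> into \<open>m\<close>, and this double
  role makes updates of own messages invisible to reads.\<close>

definition view :: "('x \<Rightarrow> 'v) \<Rightarrow> ('x \<times> 'v) list \<Rightarrow> 'x \<Rightarrow> 'v" where
  "view m b x = (case map_of b x of None \<Rightarrow> m x | Some d \<Rightarrow> d)"

lemma view_Nil [simp]: "view m [] = m"
  by (simp add: view_def fun_eq_iff)

lemma view_Cons [simp]: "view m ((x, d) # w) = (view m w)(x := d)"
  by (simp add: view_def fun_eq_iff)

lemma view_append: "view m (b @ w) = view (view m w) b"
  by (auto simp: view_def fun_eq_iff map_add_def split: option.splits)

text \<open>The memory is a parameter because no instruction changes it. Through
  \<open>view\<close>, both read rules become one.\<close>

inductive local_step ::
  "('q, 'x, 'v) process \<Rightarrow> ('x \<Rightarrow> 'v) \<Rightarrow>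
   'q \<times> ('x \<times> 'v) list \<Rightarrow> 'q \<times> ('x \<times> 'v) list \<Rightarrow> bool"
  for p :: "('q, 'x, 'v) process" and m :: "'x \<Rightarrow> 'v"
where
  rd: "(q, Rd x (view m b x), q') \<in> edges p \<Longrightarrow> local_step p m (q, b) (q', b)"
| wr: "(q, Wr x d, q') \<in> edges p \<Longrightarrow> local_step p m (q, b) (q', (x, d) # b)"
| skip: "(q, Skip, q') \<in> edges p \<Longrightarrow> local_step p m (q, b) (q', b)"
| fence: "(q, Mf, q') \<in> edges p \<Longrightarrow> local_step p m (q, []) (q', [])"

text \<open>An instruction touches only the state and buffer of its own process, so plays can be
  analysed process by process.\<close>

lemma instr_step_iff:
  "instr_step P c c' \<longleftrightarrow>
     (\<exists>i q b. local_step (P i) (mem c) (loc c i, buf c i) (q, b) \<and>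
        c' = c\<lparr>loc := (loc c)(i := q), buf := (buf c)(i := b)\<rparr>)"
proof
  assume "instr_step P c c'"
  then show "\<exists>i q b. local_step (P i) (mem c) (loc c i, buf c i) (q, b) \<and>
        c' = c\<lparr>loc := (loc c)(i := q), buf := (buf c)(i := b)\<rparr>"
  proof cases
    case (read_own_write i x d q)
    then have "local_step (P i) (mem c) (loc c i, buf c i) (q, buf c i)"
      by (intro local_step.rd[of _ x]) (simp add: view_def)
    with read_own_write show ?thesis by (intro exI[of _ i] exI) auto
  next
    case (read_from_memory i x d q)
    then have "local_step (P i) (mem c) (loc c i, buf c i) (q, buf c i)"
      by (intro local_step.rd[of _ x]) (simp add: view_def)
    with read_from_memory show ?thesis by (intro exI[of _ i] exI) auto
  next
    case (write_to_buffer i x d q)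
    then have "local_step (P i) (mem c) (loc c i, buf c i) (q, (x, d) # buf c i)"
      by (intro local_step.wr)
    with write_to_buffer show ?thesis by (intro exI[of _ i] exI) auto
  next
    case (skip_instr i q)
    then have "local_step (P i) (mem c) (loc c i, buf c i) (q, buf c i)"
      by (intro local_step.skip)
    with skip_instr show ?thesis by (intro exI[of _ i] exI) auto
  next
    case (memory_fence i q)
    then have "local_step (P i) (mem c) (loc c i, buf c i) (q, buf c i)"
      by (simp add: local_step.fence)
    moreover have "c' = c\<lparr>loc := (loc c)(i := q), buf := (buf c)(i := buf c i)\<rparr>"
      using memory_fence(1) by (simp only: fun_upd_triv) simp
    ultimately show ?thesis by (intro exI[of _ i] exI[of _ q] exI[of _ "buf c i"] conjI)
  qed
next
  assume "\<exists>i q b. local_step (P i) (mem c) (loc c i, buf c i) (q, b) \<and>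
        c' = c\<lparr>loc := (loc c)(i := q), buf := (buf c)(i := b)\<rparr>"
  then obtain i q b where step: "local_step (P i) (mem c) (loc c i, buf c i) (q, b)"
    and c': "c' = c\<lparr>loc := (loc c)(i := q), buf := (buf c)(i := b)\<rparr>"
    by blast
  from step show "instr_step P c c'"
  proof cases
    case (rd x)
    then have c'': "c' = c\<lparr>loc := (loc c)(i := q)\<rparr>"
      using c' by simp
    show ?thesis
    proof (cases "map_of (buf c i) x")
      case None
      with rd show ?thesis
        unfolding c'' by (intro instr_step.read_from_memory[where x = x]) (auto simp: view_def)
    next
      case (Some d)
      with rd show ?thesis
        unfolding c'' by (intro instr_step.read_own_write[where x = x]) (auto simp: view_def)
    qed
  next
    case (wr x d)
    then show ?thesis
      unfolding c' using instr_step.write_to_buffer[of c i x d q P] by simp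
  next
    case skip
    then show ?thesis
      unfolding c' using instr_step.skip_instr[of c i q P] by simp
  next
    case fence
    then have "(buf c)(i := b) = buf c"
      by (simp add: fun_eq_iff)
    then have "c' = c\<lparr>loc := (loc c)(i := q)\<rparr>"
      using c' by simp
    with fence show ?thesis
      using instr_step.memory_fence[of c i q P] by simp
  qed
qed

text \<open>Flushing the older messages \<open>w\<close> keeps every step enabled: reads agree by
  \<open>view_append\<close>, writes go in front of \<open>b\<close>, and a fence forces both
  \<open>b\<close> and \<open>w\<close> to be empty. The converse fails, since a fence may become
  enabled only by the flush.\<close>

lemma local_step_append:
  assumes "local_step p m (q, b @ w) (q', b')"
  shows "\<exists>b''. b' = b'' @ w \<and> local_step p (view m w) (q, b) (q', b'')"
  using assms
proof cases
  case (rd x)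
  then show ?thesis
    by (intro exI[of _ b]) (auto simp: view_append intro: local_step.rd[of _ x])
next
  case (wr x d)
  then show ?thesis
    by (intro exI[of _ "(x, d) # b"]) (simp add: local_step.wr)
next
  case skip
  then show ?thesis
    by (intro exI[of _ b]) (simp add: local_step.skip)
next
  case fence
  then show ?thesis
    by (simp add: local_step.fence)
qed

lemma local_step_states:
  assumes "is_process p" and "local_step p m v v'"
  shows "fst v \<in> states p" and "fst v' \<in> states p"
  using assms(2,1) by (cases; auto simp: is_process_def)+

lemma instr_step_confs:
  assumes "\<And>i. is_process (P i)" and "c \<in> confs P" and "instr_step P c c'"
  shows "c' \<in> confs P"
proof -
  obtain i q b where "local_step (P i) (mem c) (loc c i, buf c i) (q, b)"
    and c': "c' = c\<lparr>loc := (loc c)(i := q), buf := (buf c)(i := b)\<rparr>"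
    using assms(3) unfolding instr_step_iff by blast
  then have "q \<in> states (P i)"
    using local_step_states(2)[OF assms(1)] by fastforce
  then show ?thesis
    using assms(2) by (simp add: c' confs_def)
qed

lemma update_steps_confs:
  assumes "update_step\<^sup>*\<^sup>* c c'" and "c \<in> confs P"
  shows "c' \<in> confs P"
  using assms by induction (auto elim!: update_step.cases simp: confs_def)

section \<open>Solo runs over a fixed memory\<close>

fun achieves :: "objective \<Rightarrow> 'q set \<Rightarrow> (nat \<Rightarrow> 'q) \<Rightarrow> bool" where
  "achieves Reachability F s \<longleftrightarrow> (\<exists>n. s n \<in> F)"
| "achieves Safety F s \<longleftrightarrow> (\<forall>n. s n \<notin> F)"

text \<open>What one process can do while no update ever happens. The run is infinite for
  reachability too, because a play that stops on player A's turn is lost even after a visit to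
  \<open>F\<close>.\<close>

definition solo_run ::
  "objective \<Rightarrow> 'q set \<Rightarrow> ('q, 'x, 'v) process \<Rightarrow> ('x \<Rightarrow> 'v) \<Rightarrow> 'q \<times> ('x \<times> 'v) list \<Rightarrow> bool" where
  "solo_run obj F p m v \<longleftrightarrow>
     (\<exists>s. s 0 = v \<and> (\<forall>n. local_step p m (s n) (s (Suc n))) \<and> achieves obj F (\<lambda>n. fst (s n)))"

text \<open>Every state on a run is the source of an edge, hence lies in
  \<open>states p\<close>.\<close>

lemma solo_run_Int_states:
  assumes "is_process p"
  shows "solo_run obj (F \<inter> states p) p m v \<longleftrightarrow> solo_run obj F p m v"
proof -
  have "achieves obj (F \<inter> states p) (\<lambda>n. fst (s n)) = achieves obj F (\<lambda>n. fst (s n))"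
    if "\<forall>n. local_step p m (s n) (s (Suc n))" for s
  proof -
    have "fst (s n) \<in> states p" for n
      using that local_step_states(1)[OF assms] by blast
    then show ?thesis by (cases obj) auto
  qed
  then show ?thesis
    unfolding solo_run_def by metis
qed

section \<open>From a solo run to a winning strategy\<close>

text \<open>Player A can always move inside the invariant, so no finite play ends on her turn. The
  position \<open>k\<close> is an argument of \<open>J\<close> so that the play can follow a
  prescribed run.\<close>

lemma A_wins_invariantI:
  assumes init: "J 0 c"
    and moveA: "\<And>k g. J k g \<Longrightarrow> g \<in> confsA G \<Longrightarrow> \<exists>g'. (g, g') \<in> moves G \<and> J (Suc k) g'"
    and moveB: "\<And>k g g'. J k g \<Longrightarrow> g \<notin> confsA G \<Longrightarrow> (g, g') \<in> moves G \<Longrightarrow> J (Suc k) g'"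
    and win: "\<And>r. is_play G (InfPlay r) \<Longrightarrow> (\<And>k. J k (r k)) \<Longrightarrow> r \<in> W"
  shows "A_wins G W c"
proof -
  \<comment> \<open>A history of length \<open>k\<close> ends in position \<open>k - 1\<close>, so
    \<open>length h\<close> is the position about to be chosen.\<close>
  define good where "good h g' \<longleftrightarrow> (last h, g') \<in> moves G \<and> J (length h) g'" for h g'
  define \<sigma> where "\<sigma> h = (if \<exists>g'. good h g' then SOME g'. good h g'
    else SOME g'. (last h, g') \<in> moves G)" for h
  have good_\<sigma>: "good h (\<sigma> h)" if "good h g'" for h g'
    using that someI[of "good h"] by (auto simp: \<sigma>_def)
  have "strategy G (confsA G) \<sigma>"
    unfolding strategy_def
  proof safe
    fix h c c' assume "(c, c') \<in> moves G"
    then have some: "(c, SOME g'. (c, g') \<in> moves G) \<in> moves G" by (rule someI)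
    show "(c, \<sigma> (h @ [c])) \<in> moves G"
    proof (cases "\<exists>g'. good (h @ [c]) g'")
      case True
      then show ?thesis using good_\<sigma>[of "h @ [c]"] by (auto simp: good_def)
    next
      case False
      then show ?thesis using some by (simp add: \<sigma>_def)
    qed
  qed
  moreover have "won_by_A G W \<rho>"
    if play: "is_play G \<rho>" and first: "first_conf \<rho> = c"
      and cons: "consistent (confsA G) \<sigma> \<rho>" for \<rho>
  proof (cases \<rho>)
    case (FinPlay h)
    have J: "n < length h \<Longrightarrow> J n (h ! n)" for n
    proof (induction n)
      case 0
      then show ?case using first FinPlay init by (simp add: hd_conv_nth)
    next
      case (Suc n)
      then have Jn: "J n (h ! n)" and mv: "(h ! n, h ! Suc n) \<in> moves G"
        using play FinPlay by auto
      show ?case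
      proof (cases "h ! n \<in> confsA G")
        case True
        have *: "last (take (Suc n) h) = h ! n" "length (take (Suc n) h) = Suc n"
          using Suc.prems by (auto simp: take_Suc_conv_app_nth)
        have "h ! Suc n = \<sigma> (take (Suc n) h)"
          using cons True Suc.prems FinPlay by auto
        then show ?thesis
          using moveA[OF Jn True] good_\<sigma>[of "take (Suc n) h"] * by (auto simp: good_def)
      next
        case False
        then show ?thesis using moveB[OF Jn _ mv] by blast
      qed
    qed
    have "h \<noteq> []" using play FinPlay by simp
    then have "J (length h - 1) (last h)" using J[of "length h - 1"] by (simp add: last_conv_nth)
    then have "last h \<notin> confsA G" using moveA play FinPlay by fastforce
    moreover have "last h \<in> confsA G \<union> confsB G"
      using play FinPlay \<open>h \<noteq> []\<close> by (simp only: is_play.simps) (meson last_in_set subsetD)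
    ultimately show ?thesis using FinPlay by simp
  next
    case (InfPlay r)
    have J: "J n (r n)" for n
    proof (induction n)
      case 0
      then show ?case using first InfPlay init by simp
    next
      case (Suc n)
      have mv: "(r n, r (Suc n)) \<in> moves G" using play InfPlay by auto
      show ?case
      proof (cases "r n \<in> confsA G")
        case True
        have *: "last (map r [0..<Suc n]) = r n" "length (map r [0..<Suc n]) = Suc n"
          by auto
        have "r (Suc n) = \<sigma> (map r [0..<Suc n])"
          using cons True InfPlay by auto
        then show ?thesis
          using moveA[OF Suc True] good_\<sigma>[of "map r [0..<Suc n]"] *
          unfolding good_def by metis
      next
        case False
        then show ?thesis using moveB[OF Suc _ mv] by blast
      qed
    qed
    then show ?thesis using win[of r] play InfPlay by simp
  qed
  ultimately show ?thesis unfolding A_wins_def by blast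
qed

text \<open>
  In the invariant, \<open>w\<close> collects the messages of process \<open>i\<close> that have already reached the memory.
\<close>

lemma solo_run_imp_A_wins:
  fixes P :: "('i, 'q, 'x, 'v) program"
  assumes proc: "\<And>i. is_process (P i)"
    and c: "c \<in> confs P"
    and buf: "\<And>j. j \<noteq> i \<Longrightarrow> buf c j = []"
    and loc: "\<And>j. j \<noteq> i \<Longrightarrow> loc c j \<notin> F"
    and run: "solo_run obj F (P i) (mem c) (loc c i, buf c i)"
  shows "A_wins (tso_game P) (winning_condition obj P F) (ConfA c)"
proof -
  obtain s where s0: "s 0 = (loc c i, buf c i)"
    and s: "\<And>n. local_step (P i) (mem c) (s n) (s (Suc n))"
    and obj: "achieves obj F (\<lambda>n. fst (s n))"
    using run unfolding solo_run_def by blast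
  define I where "I n d \<longleftrightarrow> d \<in> confs P \<and> (\<forall>j. j \<noteq> i \<longrightarrow> loc d j = loc c j \<and> buf d j = []) \<and>
    (\<exists>w. s n = (loc d i, buf d i @ w) \<and> mem d = view (mem c) w)" for n and d :: "('i, 'q, 'x, 'v) conf"
  have I0: "I 0 c"
    using c buf s0 by (auto simp: I_def)
  have I_step: "\<exists>d'. instr_step P d d' \<and> I (Suc n) d'" if d: "I n d" for n d
  proof -
    obtain w where w: "s n = (loc d i, buf d i @ w)" and m: "mem d = view (mem c) w"
      using d unfolding I_def by blast
    obtain q b where qb: "s (Suc n) = (q, b)" by (cases "s (Suc n)")
    have "local_step (P i) (mem c) (loc d i, buf d i @ w) (q, b)"
      using s[of n] w qb by simp
    \<comment> \<open>The run keeps \<open>w\<close> in its buffer, while in the game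
      \<open>w\<close> is already in memory; \<open>local_step_append\<close> transfers the
      step.\<close>
    then obtain b' where b': "b = b' @ w"
      and step: "local_step (P i) (mem d) (loc d i, buf d i) (q, b')"
      using local_step_append m by metis
    define d' where "d' = d\<lparr>loc := (loc d)(i := q), buf := (buf d)(i := b')\<rparr>"
    have "instr_step P d d'"
      unfolding instr_step_iff d'_def using step by blast
    moreover from this have "I (Suc n) d'"
      using d instr_step_confs[OF proc] m qb b' by (fastforce simp: I_def d'_def)
    ultimately show ?thesis by blast
  qed
  have I_update: "I n d'" if "update_step\<^sup>*\<^sup>* d d'" and "I n d" for n d d'
    using that
  proof induction
    case (step d d')
    from step.hyps(2) show ?case
    proof cases
      case (update j b x e)
      have I: "I n d" using step by blast
      \<comment> \<open>All other buffers are empty, so the update flushes the oldest message of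
        process \<open>i\<close>, which joins \<open>w\<close> at the front.\<close>
      then have j: "j = i" using update by (force simp: I_def)
      obtain w where "s n = (loc d i, buf d i @ w)" "mem d = view (mem c) w"
        using I unfolding I_def by blast
      then have "s n = (loc d' i, buf d' i @ (x, e) # w) \<and> mem d' = view (mem c) ((x, e) # w)"
        using update j by simp
      moreover have "d' \<in> confs P"
        using I update by (auto simp: I_def confs_def)
      moreover have "\<forall>j. j \<noteq> i \<longrightarrow> loc d' j = loc c j \<and> buf d' j = []"
        using I update j by (auto simp: I_def)
      ultimately show ?thesis unfolding I_def by blast
    qed
  qed
  \<comment> \<open>Player A moves at even positions, and one round takes two positions. Her move
    advances the run, so an odd position already matches index \<open>Suc (k div 2)\<close>.\<close>
  define J where "J k g \<longleftrightarrow>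
    (if even k then \<exists>d. g = ConfA d \<and> I (k div 2) d else \<exists>d. g = ConfB d \<and> I (Suc (k div 2)) d)"
    for k g
  show ?thesis
  proof (rule A_wins_invariantI[where J = J])
    show "J 0 (ConfA c)" using I0 by (simp add: J_def)
  next
    fix k g assume J: "J k g" and g: "g \<in> confsA (tso_game P)"
    then obtain d where "g = ConfA d" "I (k div 2) d" "even k" "d \<in> confs P"
      by (auto simp: J_def tso_game_def split: if_splits)
    then show "\<exists>g'. (g, g') \<in> moves (tso_game P) \<and> J (Suc k) g'"
      using I_step[of "k div 2" d] by (auto simp: J_def tso_game_def)
  next
    fix k g g' assume J: "J k g" and g: "g \<notin> confsA (tso_game P)"
      and mv: "(g, g') \<in> moves (tso_game P)"
    then obtain d where d: "g = ConfB d" "I (Suc (k div 2)) d" "odd k"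
      by (auto simp: J_def tso_game_def I_def split: if_splits)
    then obtain d' where "g' = ConfA d'" "update_step\<^sup>*\<^sup>* d d'"
      using mv by (auto simp: tso_game_def)
    then show "J (Suc k) g'"
      using d I_update by (auto simp: J_def elim!: oddE)
  next
    fix r assume play: "is_play (tso_game P) (InfPlay r)" and J: "\<And>k. J k (r k)"
    have inf: "r \<in> infinite_plays (tso_game P)"
      using play by (simp add: infinite_plays_def)
    show "r \<in> winning_condition obj P F"
    proof (cases obj)
      case Reachability
      then obtain n where n: "fst (s n) \<in> F" using obj by auto
      have "\<exists>d. r (2 * n) = ConfA d \<and> I n d" using J[of "2 * n"] by (simp add: J_def)
      then have "r (2 * n) \<in> target_confs P F"
        using n by (auto simp: target_confs_def I_def)
      then show ?thesis using Reachability inf by auto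
    next
      case Safety
      have "r k \<notin> target_confs P F" for k
      proof -
        obtain n where "I n (conf_of (r k))"
          using J[of k] by (auto simp: J_def split: if_splits)
        \<comment> \<open>Process \<open>i\<close> is safe along the run; the others never leave
          their initial states.\<close>
        then have "loc (conf_of (r k)) j \<notin> F" for j
          using obj Safety loc by (cases "j = i") (auto simp: I_def dest!: spec[of _ n])
        then show ?thesis by (simp add: target_confs_def)
      qed
      then show ?thesis using Safety inf by simp
    qed
  qed
qed

section \<open>From a winning strategy to a solo run\<close>

text \<open>The winning strategy is played against an update player who never updates.
  \<open>W\<close> is arbitrary because the lemma serves both the objectives and the game in
  \<open>no_deadlock_from\<close>.\<close>

lemma A_wins_imp_path:
  assumes proc: "\<And>i. is_process (P i)"
    and c: "c \<in> confs P"
    and wins: "A_wins (tso_game P) W (ConfA c)"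
  obtains f r where "f 0 = c" "\<And>n. instr_step P (f n) (f (Suc n))" "\<And>n. f n \<in> confs P"
    "r \<in> W" "\<And>n. r (2 * n) = ConfA (f n)" "\<And>n. r (Suc (2 * n)) = ConfB (f (Suc n))"
proof -
  let ?G = "tso_game P"
  obtain \<sigma> where \<sigma>: "strategy ?G (confsA ?G) \<sigma>"
    and win: "\<And>\<tau> \<rho>. \<lbrakk>strategy ?G (confsB ?G) \<tau>; is_play ?G \<rho>; first_conf \<rho> = ConfA c;
      consistent (confsA ?G) \<sigma> \<rho>; consistent (confsB ?G) \<tau> \<rho>\<rbrakk> \<Longrightarrow> won_by_A ?G W \<rho>"
    using wins unfolding A_wins_def by blast
  \<comment> \<open>Zero updates are always a legal move.\<close>
  define \<tau> :: "('a, 'b, 'c, 'd) conf game_conf list \<Rightarrow> ('a, 'b, 'c, 'd) conf game_conf"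
    where "\<tau> h = ConfA (conf_of (last h))" for h
  have \<tau>: "strategy ?G (confsB ?G) \<tau>"
    by (auto simp: strategy_def \<tau>_def tso_game_def)
  \<comment> \<open>Whole histories are iterated because \<sigma> may depend on the entire
    past.\<close>
  define hist where "hist n =
    ((\<lambda>h. h @ [case last h of ConfA _ \<Rightarrow> \<sigma> h | ConfB _ \<Rightarrow> \<tau> h]) ^^ n) [ConfA c]" for n
  define r where "r n = last (hist n)" for n
  have hist: "hist n = map r [0..<Suc n]" for n
    by (induction n) (simp_all add: hist_def r_def)
  have r0: "r 0 = ConfA c" by (simp add: r_def hist_def)
  have rA: "r (Suc n) = \<sigma> (map r [0..<Suc n])" if "r n = ConfA d" for n d
    using that unfolding hist[symmetric] by (simp add: r_def hist_def)
  have rB: "r (Suc n) = ConfA d" if "r n = ConfB d" for n d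
    using that by (simp add: r_def hist_def \<tau>_def)
  have consA: "r (Suc n) = \<sigma> (map r [0..<Suc n])" if "r n \<in> confsA ?G" for n
    using that rA by (auto simp: tso_game_def)
  have consB: "r (Suc n) = \<tau> (map r [0..<Suc n])" if "r n \<in> confsB ?G" for n
    using that rB by (auto simp: tso_game_def \<tau>_def)
  have move_confs: "g' \<in> confsA ?G \<union> confsB ?G" if "(g, g') \<in> moves ?G" for g g'
    using that instr_step_confs[OF proc] update_steps_confs by (fastforce simp: tso_game_def)
  have legal: "(r n, r (Suc n)) \<in> moves ?G" if "r n \<in> confsA ?G \<union> confsB ?G"
    and "(r n, g) \<in> moves ?G" for n g
  proof -
    have "map r [0..<Suc n] = map r [0..<n] @ [r n]" by simp
    then show ?thesis using that consA consB \<sigma> \<tau> unfolding strategy_def by (metis UnE)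
  qed
  have c_in: "r 0 \<in> confsA ?G \<union> confsB ?G" using c r0 by (auto simp: tso_game_def)
  \<comment> \<open>At the first failure, the prefix ending in \<open>r n\<close> would be a finite
    play. Since player A wins it, it ends on the turn of player B, who can always move without
    updating. Strong induction makes all earlier moves legal.\<close>
  have inf: "(r n, r (Suc n)) \<in> moves ?G" for n
  proof (induction n rule: less_induct)
    case (less n)
    have confs: "r k \<in> confsA ?G \<union> confsB ?G" if "k \<le> n" for k
    proof (cases k)
      case 0
      then show ?thesis using c_in by simp
    next
      case (Suc l)
      then show ?thesis using that move_confs[OF less[of l]] by simp
    qed
    show ?case
    proof (rule ccontr)
      assume "(r n, r (Suc n)) \<notin> moves ?G"
      then have stuck: "(r n, g) \<notin> moves ?G" for g using legal confs by blast
      let ?h = "map r [0..<Suc n]"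
      have nth: "?h ! k = r k" if "k < Suc n" for k
        using that by (simp del: upt_Suc)
      have take: "take (Suc k) ?h = map r [0..<Suc k]" if "k < Suc n" for k
        using that by (simp del: upt_Suc add: take_map)
      have "r k \<in> confsA ?G \<union> confsB ?G" if "k < Suc n" for k
        using confs that by simp
      then have "set ?h \<subseteq> confsA ?G \<union> confsB ?G"
        unfolding set_map by (intro image_subsetI) (simp only: set_upt atLeastLessThan_iff)
      then have "is_play ?G (FinPlay ?h)"
        using less.IH stuck nth by (auto simp del: upt_Suc simp: last_map)
      moreover have "first_conf (FinPlay ?h) = ConfA c"
        using r0 by (simp add: hd_map del: upt_Suc)
      moreover have "consistent (confsA ?G) \<sigma> (FinPlay ?h)" "consistent (confsB ?G) \<tau> (FinPlay ?h)"
        using consA consB nth take by (auto simp del: upt_Suc)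
      ultimately have "won_by_A ?G W (FinPlay ?h)" using win[OF \<tau>] by blast
      then have "r n \<in> confsB ?G" by simp
      then obtain d where "r n = ConfB d" "d \<in> confs P" by (auto simp: tso_game_def)
      then have "(r n, ConfA d) \<in> moves ?G" by (auto simp: tso_game_def)
      then show False using stuck by blast
    qed
  qed
  have confs: "r n \<in> confsA ?G \<union> confsB ?G" for n
    using c_in move_confs[OF inf] by (cases n) auto
  have "won_by_A ?G W (InfPlay r)"
  proof (rule win[OF \<tau>])
    show "is_play ?G (InfPlay r)" using confs inf by auto
  qed (use r0 consA consB in \<open>auto simp del: upt_Suc\<close>)
  then have W: "r \<in> W" by simp
  define f where "f n = conf_of (r (2 * n))" for n
  have step: "\<exists>d'. r (Suc n) = ConfB d' \<and> instr_step P d d' \<and> r (Suc (Suc n)) = ConfA d'"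
    if "r n = ConfA d" for n d
    using inf[of n] rB[of "Suc n"] that by (auto simp: tso_game_def)
  have even: "r (2 * n) = ConfA (f n)" for n
  proof (induction n)
    case 0
    then show ?case by (simp add: f_def r0)
  next
    case (Suc n)
    then show ?case using step[OF Suc] by (auto simp: f_def)
  qed
  have odd: "r (Suc (2 * n)) = ConfB (f (Suc n))" "instr_step P (f n) (f (Suc n))" for n
    using step[OF even[of n]] even[of "Suc n"] by auto
  have "f n \<in> confs P" for n
    using confs[of "2 * n"] even[of n] by (auto simp: tso_game_def)
  moreover have "f 0 = c"
    by (simp add: f_def r0)
  ultimately show thesis
    using that odd even W by metis
qed

lemma path_mem:
  assumes "\<And>n. instr_step P (f n) (f (Suc n))"
  shows "mem (f n) = mem (f 0)"
proof (induction n)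
  case (Suc n)
  then show ?case using assms[of n] by (auto simp: instr_step_iff)
qed simp

text \<open>Prepending a step only shifts the visit to \<open>F\<close> by one index. For safety,
  \<open>u\<close> itself would have to avoid \<open>F\<close>.\<close>

lemma solo_run_Reachability_step:
  assumes "local_step p m u v" and "solo_run Reachability F p m v"
  shows "solo_run Reachability F p m u"
proof -
  obtain s where "s 0 = v" "\<And>n. local_step p m (s n) (s (Suc n))" "\<exists>n. fst (s n) \<in> F"
    using assms(2) by (auto simp: solo_run_def)
  then show ?thesis
    unfolding solo_run_def using assms(1)
    by (intro exI[of _ "case_nat u s"])
      (auto split: nat.splits intro: exI[of _ "Suc _"])
qed

text \<open>Against an idle update player, the strategy from \<open>no_deadlock_from\<close> yields
  an infinite run over the constant memory \<open>m\<close>; its index 0 is already in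
  \<open>F\<close>.\<close>

lemma no_deadlock_imp_solo_run:
  assumes proc: "is_process p" and nd: "no_deadlock_from p F" and q: "q \<in> F" "q \<in> states p"
  shows "solo_run Reachability F p m (q, b)"
proof -
  let ?c = "\<lparr>loc = \<lambda>_. q, buf = \<lambda>_. b, mem = m\<rparr> :: (unit, _, _, _) conf"
  have c: "?c \<in> confs (single p)" using q by (simp add: confs_def single_def)
  then have "A_wins (tso_game (single p)) (infinite_plays (tso_game (single p))) (ConfA ?c)"
    using nd q by (simp add: no_deadlock_from_def)
  then obtain f where f0: "f 0 = ?c" and f: "\<And>n. instr_step (single p) (f n) (f (Suc n))"
    using A_wins_imp_path[OF _ c] proc by (metis single_def)
  have "local_step p m (loc (f n) (), buf (f n) ()) (loc (f (Suc n)) (), buf (f (Suc n)) ())" for n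
    using f[of n] path_mem[of _ f n, OF f] f0 by (auto simp: instr_step_iff single_def)
  then show ?thesis
    unfolding solo_run_def using f0 q
    by (intro exI[of _ "\<lambda>n. (loc (f n) (), buf (f n) ())"]) (auto intro: exI[of _ 0])
qed

text \<open>With an idle update player the winning play interleaves local runs over one constant
  memory. Finiteness of the index type (safety) or absence of deadlocks (reachability) makes one of
  them infinite.\<close>

lemma A_wins_imp_solo_run:
  fixes P :: "('i::finite, 'q, 'x, 'v) program"
  assumes proc: "\<And>i. is_process (P i)"
    and c: "c \<in> confs P"
    and nd: "obj = Reachability \<longrightarrow> (\<forall>i. no_deadlock_from (P i) (F \<inter> states (P i)))"
    and wins: "A_wins (tso_game P) (winning_condition obj P F) (ConfA c)"
  shows "\<exists>i. solo_run obj F (P i) (mem c) (loc c i, buf c i)"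
proof -
  obtain f r where f0: "f 0 = c" and f: "\<And>n. instr_step P (f n) (f (Suc n))"
    and f_confs: "\<And>n. f n \<in> confs P" and r: "r \<in> winning_condition obj P F"
    and rA: "\<And>n. r (2 * n) = ConfA (f n)" and rB: "\<And>n. r (Suc (2 * n)) = ConfB (f (Suc n))"
    using A_wins_imp_path[OF proc c wins] by metis
  \<comment> \<open>The target may be visited on either player's turn; both kinds of positions show
    a configuration of the path \<open>f\<close>.\<close>
  have rf: "\<exists>k. conf_of (r n) = f k" for n
    by (cases "even n") (auto elim!: evenE oddE simp: rA rB)
  define v where "v i n = (loc (f n) i, buf (f n) i)" for i n
  have "\<exists>i. local_step (P i) (mem c) (v i n) (v i (Suc n)) \<and> (\<forall>j. j \<noteq> i \<longrightarrow> v j (Suc n) = v j n)"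
    for n
    using f[of n] path_mem[of _ f n, OF f] f0 unfolding instr_step_iff v_def by fastforce
  \<comment> \<open>\<open>p n\<close> is the process that moves in round \<open>n\<close>.\<close>
  then obtain p where p: "\<And>n. local_step (P (p n)) (mem c) (v (p n) n) (v (p n) (Suc n))"
    and idle: "\<And>n j. j \<noteq> p n \<Longrightarrow> v j (Suc n) = v j n"
    by metis
  show ?thesis
  proof (cases obj)
    case Reachability
    then obtain n where "r n \<in> target_confs P F" using r by auto
    then obtain k i where k: "loc (f k) i \<in> F" "loc (f k) i \<in> states (P i)"
      using rf[of n] f_confs by (auto simp: target_confs_def confs_def)
    have "solo_run Reachability (F \<inter> states (P i)) (P i) (mem c) (v i k)"
      using no_deadlock_imp_solo_run[OF proc] nd k Reachability by (simp add: v_def)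
    then have "solo_run Reachability F (P i) (mem c) (v i k)"
      using solo_run_Int_states[OF proc] by blast
    \<comment> \<open>Going back to round 0, a round of process \<open>i\<close> prepends a step and
      any other round leaves \<open>v i\<close> unchanged.\<close>
    then have "solo_run Reachability F (P i) (mem c) (v i 0)"
    proof (induction k)
      case (Suc k)
      then show ?case
        using solo_run_Reachability_step[of "P i" "mem c" "v i k" "v i (Suc k)" F]
          p[of k] idle[of i k] by (cases "p k = i") auto
    qed
    then show ?thesis using Reachability f0 by (auto simp: v_def)
  next
    case Safety
    have safe: "fst (v i n) \<notin> F" for i n
    proof -
      have "r (2 * n) \<notin> target_confs P F" using r Safety by auto
      then show ?thesis using rA f_confs by (auto simp: target_confs_def v_def)
    qed
    \<comment> \<open>Finitely many processes share infinitely many rounds.\<close>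
    obtain i where "infinite {n. p n = i}"
      using pigeonhole_infinite[of "UNIV :: nat set" p] by auto
    then have inf: "\<exists>k\<ge>n. p k = i" for n
      unfolding finite_nat_set_iff_bounded by (metis mem_Collect_eq not_less)
    \<comment> \<open>Process \<open>i\<close> keeps its state and buffer until its next turn, so
      the step taken then already starts from \<open>v i n\<close>.\<close>
    have next_step: "\<exists>k. local_step (P i) (mem c) (v i n) (v i k)" for n
    proof -
      obtain k where k: "n \<le> k" "p k = i" using inf by blast
      then have "\<exists>k\<ge>n. local_step (P i) (mem c) (v i n) (v i (Suc k))"
      proof (induction rule: inc_induct)
        case base
        then show ?case using p[of k] by auto
      next
        case (step n)
        show ?case
        proof (cases "p n = i")
          case True
          then show ?thesis using p[of n] by auto
        next
          case False
          then show ?thesis using step idle[of i n] by (metis Suc_leD)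
        qed
      qed
      then show ?thesis by blast
    qed
    obtain t where t: "\<And>n. local_step (P i) (mem c) (v i n) (v i (t n))"
      using next_step by metis
    \<comment> \<open>Iterating \<open>t\<close> from 0 chains local steps, and every entry is some
      \<open>v i k\<close>, so \<open>safe\<close> applies.\<close>
    have "solo_run Safety F (P i) (mem c) (v i 0)"
      unfolding solo_run_def using t safe
      by (intro exI[of _ "\<lambda>n. v i ((t ^^ n) 0)"]) auto
    then show ?thesis using Safety f0 by (auto simp: v_def)
  qed
qed

section \<open>The characterization, applied to both games\<close>

text \<open>The finite index type is left open so that the result covers \<open>P\<close> as well as
  each \<open>single (P i)\<close>, indexed by \<open>unit\<close>.\<close>

lemma A_wins_iff_solo_run:
  fixes P :: "('i::finite, 'q, 'x, 'v) program"
  assumes "\<And>i. is_process (P i)"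
    and "obj = Reachability \<longrightarrow> (\<forall>i. no_deadlock_from (P i) (F \<inter> states (P i)))"
    and "c \<in> confs P" and "\<And>i. buf c i = []" and "\<And>i. loc c i \<notin> F"
  shows "A_wins (tso_game P) (winning_condition obj P F) (ConfA c) \<longleftrightarrow>
    (\<exists>i. solo_run obj F (P i) (mem c) (loc c i, buf c i))"
proof
  show "\<exists>i. solo_run obj F (P i) (mem c) (loc c i, buf c i)"
    if "A_wins (tso_game P) (winning_condition obj P F) (ConfA c)"
    using assms(1,3,2) that by (rule A_wins_imp_solo_run)
next
  assume "\<exists>i. solo_run obj F (P i) (mem c) (loc c i, buf c i)"
  then obtain i where "solo_run obj F (P i) (mem c) (loc c i, buf c i)" ..
  then show "A_wins (tso_game P) (winning_condition obj P F) (ConfA c)"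
    using solo_run_imp_A_wins[OF assms(1,3), of i F obj] assms(4,5) by simp
qed

theorem theorem1:
  fixes P :: "('i::finite, 'q, 'x::finite, 'v::finite) program"
    and F :: "'q set"
    and obj :: objective
    and c0 :: "('i, 'q, 'x, 'v) conf"
  assumes "\<And>i. is_process (P i)"
    and "F \<subseteq> (\<Union>i. states (P i))"
    and "obj = Reachability \<longrightarrow> (\<forall>i. no_deadlock_from (P i) (F \<inter> states (P i)))"
    and "c0 \<in> confs P"
    and "\<And>i. buf c0 i = []"
    and "\<And>i. loc c0 i \<notin> F"
  shows "A_wins (tso_game P) (winning_condition obj P F) (ConfA c0) \<longleftrightarrow>
    (\<exists>i. A_wins (tso_game (single (P i)))
           (winning_condition obj (single (P i)) (F \<inter> states (P i)))
           (ConfA (proj i c0)))"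
proof -
  \<comment> \<open>\<open>proj i c0\<close> keeps the state, buffer and memory seen by process
    \<open>i\<close>, so its own game asks for the same solo run; \<open>solo_run_Int_states\<close>
    removes the restriction of \<open>F\<close>.\<close>
  have "A_wins (tso_game (single (P i)))
      (winning_condition obj (single (P i)) (F \<inter> states (P i))) (ConfA (proj i c0)) \<longleftrightarrow>
    solo_run obj F (P i) (mem c0) (loc c0 i, buf c0 i)" for i
    using A_wins_iff_solo_run[of "single (P i)" obj "F \<inter> states (P i)" "proj i c0"] assms
      solo_run_Int_states[OF assms(1), of obj F i]
    by (simp add: single_def proj_def confs_def Int_assoc)
  then show ?thesis
    using A_wins_iff_solo_run[of P obj F c0, OF assms(1,3-6)] by (simp only:)
qed

end
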